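(* Let $G$ be a compact abelian group with dual group $\hat G$, and let $w:\hat G\to(0,\infty)$ be a weight bounded away from $0$. Put $\lambda=w^{-2}$. Assume that there is a constant $C$ with $(w^{-1}*w^{-1})(\gamma)\le C w^{-1}(\gamma)$ for all $\gamma\in\hat G$; that $\lambda\in L^1(\hat G)$ is strictly positive, symmetric ($\lambda(-\gamma)=\lambda(\gamma)$) and subconvolutive ($\lambda*\lambda\le C'\lambda$ pointwise for some constant $C'$); and that for every $\epsilon>0$ the function $\lambda^\epsilon=w^{-2\epsilon}$ lies in $L^1(\hat G)$ and is strictly positive, symmetric, and subconvolutive (with a constant that may depend on $\epsilon$). Then for every $\epsilon>0$ one has a continuous embedding $\mathcal H_{\lambda^{1+\epsilon}}\hookrightarrow\mathcal A_w$.
   Context: $G$ carries its normalized (probability) Haar measure $\mu$, and the dual group $\hat G$ (continuous homomorphisms $\gamma: G\to S^1\subset\mathbb C$, written additively) is discrete with counting measure. $L^1(\hat G)=\ell^1(\hat G)$, and $(a*b)(\gamma)=\sum_{\gamma'\in\hat G}a(\gamma-\gamma')b(\gamma')$. $\mathcal F f(\gamma)=\int_G f(x)\gamma(-x)\,d\mu(x)$. The Fourier–Wermer space is $\mathcal A_w=\{f\in L^1(G):\sum_{\gamma\in\hat G}w(\gamma)|\mathcal F f(\gamma)|<\infty\}$ with norm $\|f\|_{\mathcal A_w}=\sum_{\gamma}w(\gamma)|\mathcal F f(\gamma)|$. For strictly positive $\kappa\in L^1(\hat G)$, $\mathcal H_\kappa$ is the reproducing kernel Hilbert space on $G$ with kernel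 $(x,y)\mapsto\sum_{\gamma\in\hat G}\kappa(\gamma)\gamma(x-y)$; explicitly $\mathcal H_\kappa=\{f\in C(G):\sum_\gamma|\mathcal F f(\gamma)|^2/\kappa(\gamma)<\infty\}$ with $\|f\|_{\mathcal H_\kappa}^2=\sum_\gamma|\mathcal F f(\gamma)|^2/\kappa(\gamma)$. The embedding is the identity map on functions. *)

theory Defs
  imports "HOL-Probability.Probability_Measure"
begin

text \<open>
  The compact abelian group is a type of sort \<open>{topological_ab_group_add, t2_space}\<close> whose
  universe is compact (topological groups are Hausdorff by convention).
\<close>

section \<open>The dual group\<close>

typedef (overloaded) 'g dual =
  "{\<gamma> :: 'g::topological_ab_group_add \<Rightarrow> complex.
      continuous_on UNIV \<gamma> \<and> (\<forall>x. cmod (\<gamma> x) = 1) \<and> (\<forall>x y. \<gamma> (x + y) = \<gamma> x * \<gamma> y)}"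
  morphisms dual_app Abs_dual
  by (rule exI[of _ "\<lambda>_. 1"]) simp

setup_lifting type_definition_dual

text \<open>The group law of the dual is pointwise multiplication of characters, written additively.\<close>

instantiation dual :: (topological_ab_group_add) ab_group_add
begin

lift_definition zero_dual :: "'a dual" is "\<lambda>_. 1"
  by simp

lift_definition plus_dual :: "'a dual \<Rightarrow> 'a dual \<Rightarrow> 'a dual" is "\<lambda>\<gamma> \<delta> x. \<gamma> x * \<delta> x"
  by (auto simp: norm_mult intro: continuous_on_mult)

lift_definition uminus_dual :: "'a dual \<Rightarrow> 'a dual" is "\<lambda>\<gamma> x. inverse (\<gamma> x)"
  by (auto simp: norm_inverse intro!: continuous_on_inverse) (metis norm_zero zero_neq_one)

lift_definition minus_dual :: "'a dual \<Rightarrow> 'a dual \<Rightarrow> 'a dual" is "\<lambda>\<gamma> \<delta> x. \<gamma> x * inverse (\<delta> x)"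
  by (auto simp: norm_mult norm_inverse intro!: continuous_on_mult continuous_on_inverse)
    (metis norm_zero zero_neq_one)

instance
proof
  fix a b c :: "'a dual"
  show "a + b + c = a + (b + c)" by transfer (simp add: mult.assoc)
  show "a + b = b + a" by transfer (simp add: mult.commute)
  show "0 + a = a" by transfer simp
  show "- a + a = 0"
  proof transfer
    fix \<gamma> :: "'a \<Rightarrow> complex"
    assume \<gamma>: "continuous_on UNIV \<gamma> \<and> (\<forall>x. cmod (\<gamma> x) = 1) \<and> (\<forall>x y. \<gamma> (x + y) = \<gamma> x * \<gamma> y)"
    have "\<gamma> x \<noteq> 0" for x
      using \<gamma> by (metis norm_zero zero_neq_one)
    then show "(\<lambda>x. inverse (\<gamma> x) * \<gamma> x) = (\<lambda>_. 1)" by auto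
  qed
  show "a - b = a + - b" by transfer simp
qed

end

section \<open>Haar measure and Fourier transform\<close>

text \<open>Regularity is part of the definition since the group need not be metrizable.\<close>

definition normalized_haar :: "'g::{topological_ab_group_add, t2_space} measure \<Rightarrow> bool" where
  "normalized_haar \<mu> \<longleftrightarrow>
     prob_space \<mu> \<and> sets \<mu> = sets borel \<and>
     (\<forall>x. \<forall>A\<in>sets borel. emeasure \<mu> ((+) x ` A) = emeasure \<mu> A) \<and>
     (\<forall>A\<in>sets borel. emeasure \<mu> A = (SUP K\<in>{K. K \<subseteq> A \<and> compact K}. emeasure \<mu> K)) \<and>
     (\<forall>A\<in>sets borel. emeasure \<mu> A = (INF U\<in>{U. A \<subseteq> U \<and> open U}. emeasure \<mu> U))"

definition fourier ::
    "'g::topological_ab_group_add measure \<Rightarrow> ('g \<Rightarrow> complex) \<Rightarrow> 'g dual \<Rightarrow> complex" where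
  "fourier \<mu> f \<gamma> = (LINT x|\<mu>. f x * dual_app \<gamma> (- x))"

section \<open>Functions on the dual group\<close>

definition ell1 :: "('d \<Rightarrow> real) set" where
  "ell1 = {a. (\<lambda>\<gamma>. norm (a \<gamma>)) summable_on UNIV}"

definition dual_conv :: "('d::ab_group_add \<Rightarrow> real) \<Rightarrow> ('d \<Rightarrow> real) \<Rightarrow> 'd \<Rightarrow> real" where
  "dual_conv a b \<gamma> = (\<Sum>\<^sub>\<infinity>\<gamma>'. a (\<gamma> - \<gamma>') * b \<gamma>')"

text \<open>
  As \<^const>\<open>infsum\<close> is 0 on divergent sums, convergence of the convolution is demanded explicitly;
  for nonnegative \<open>a\<close> this is the inequality in \<open>[0, \<infinity>]\<close>.
\<close>

definition subconvolutive :: "('d::ab_group_add \<Rightarrow> real) \<Rightarrow> bool" where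
  "subconvolutive a \<longleftrightarrow>
     (\<exists>C. \<forall>\<gamma>. (\<lambda>\<gamma>'. a (\<gamma> - \<gamma>') * a \<gamma>') summable_on UNIV \<and> dual_conv a a \<gamma> \<le> C * a \<gamma>)"

section \<open>The function spaces\<close>

text \<open>
  Elements of \<open>L\<^sup>1\<close> are represented by integrable functions; the classes modulo equality almost
  everywhere are accounted for in \<open>continuously_embedded\<close> below.
\<close>

definition wermer_space ::
    "'g::topological_ab_group_add measure \<Rightarrow> ('g dual \<Rightarrow> real) \<Rightarrow> ('g \<Rightarrow> complex) set" where
  "wermer_space \<mu> w =
     {f. integrable \<mu> f \<and> (\<lambda>\<gamma>. w \<gamma> * cmod (fourier \<mu> f \<gamma>)) summable_on UNIV}"

definition wermer_norm ::
    "'g::topological_ab_group_add measure \<Rightarrow> ('g dual \<Rightarrow> real) \<Rightarrow> ('g \<Rightarrow> complex) \<Rightarrow> real" where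
  "wermer_norm \<mu> w f = (\<Sum>\<^sub>\<infinity>\<gamma>. w \<gamma> * cmod (fourier \<mu> f \<gamma>))"

definition rkhs ::
    "'g::topological_ab_group_add measure \<Rightarrow> ('g dual \<Rightarrow> real) \<Rightarrow> ('g \<Rightarrow> complex) set" where
  "rkhs \<mu> \<kappa> =
     {f. continuous_on UNIV f \<and> (\<lambda>\<gamma>. (cmod (fourier \<mu> f \<gamma>))\<^sup>2 / \<kappa> \<gamma>) summable_on UNIV}"

definition rkhs_norm ::
    "'g::topological_ab_group_add measure \<Rightarrow> ('g dual \<Rightarrow> real) \<Rightarrow> ('g \<Rightarrow> complex) \<Rightarrow> real" where
  "rkhs_norm \<mu> \<kappa> f = sqrt (\<Sum>\<^sub>\<infinity>\<gamma>. (cmod (fourier \<mu> f \<gamma>))\<^sup>2 / \<kappa> \<gamma>)"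

text \<open>
  \<open>X\<close> is a space of genuine functions, \<open>Y\<close> a space of functions modulo equality \<open>\<mu>\<close>-almost
  everywhere, and the map is \<open>f \<mapsto> f\<close>: it is well defined, injective into classes, continuous for
  the two norms, and (equivalently to continuity, by linearity) bounded.
\<close>

definition continuously_embedded ::
    "'g measure \<Rightarrow> ('g \<Rightarrow> complex) set \<Rightarrow> (('g \<Rightarrow> complex) \<Rightarrow> real) \<Rightarrow>
     ('g \<Rightarrow> complex) set \<Rightarrow> (('g \<Rightarrow> complex) \<Rightarrow> real) \<Rightarrow> bool" where
  "continuously_embedded \<mu> X nX Y nY \<longleftrightarrow>
     X \<subseteq> Y \<and>
     (\<forall>f\<in>X. \<forall>g\<in>X. (AE x in \<mu>. f x = g x) \<longrightarrow> f = g) \<and>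
     (\<forall>f\<in>X. \<forall>e>0. \<exists>d>0. \<forall>g\<in>X.
        nX (\<lambda>x. g x - f x) < d \<longrightarrow> nY (\<lambda>x. g x - f x) < e) \<and>
     (\<exists>C. \<forall>f\<in>X. nY f \<le> C * nX f)"

end

theory Submission
  imports Defs
begin

text \<open>
  With \<open>\<kappa> = \<lambda>\<^sup>1\<^sup>+\<^sup>\<epsilon>\<close> one has \<open>w\<^sup>2 \<kappa> = \<lambda>\<^sup>\<epsilon>\<close>, which is summable. Writing \<open>w |Ff|\<close> as
  \<open>(w \<kappa>\<^sup>1\<^sup>/\<^sup>2) (|Ff| / \<kappa>\<^sup>1\<^sup>/\<^sup>2)\<close>, the Cauchy--Schwarz inequality bounds the Wermer norm of \<open>f\<close> by
  \<open>\<parallel>\<lambda>\<^sup>\<epsilon>\<parallel>\<^sub>1\<^sup>1\<^sup>/\<^sup>2\<close> times its norm in the reproducing kernel Hilbert space. Continuous functions that agree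
  almost everywhere are equal because a nonempty open set has positive Haar measure: by
  compactness, finitely many of its translates cover the group.
\<close>

text \<open>The finite inequality bounds every partial sum by one constant independent of
  \<open>F\<close>. As the terms are nonnegative, this bound yields summability and then passes to
  the infinite sum.\<close>

lemma Cauchy_Schwarz_infsum:
  fixes a b :: "'i \<Rightarrow> real"
  assumes a: "(\<lambda>i. (a i)\<^sup>2) summable_on A" and b: "(\<lambda>i. (b i)\<^sup>2) summable_on A"
    and nonneg: "\<And>i. i \<in> A \<Longrightarrow> 0 \<le> a i" "\<And>i. i \<in> A \<Longrightarrow> 0 \<le> b i"
  shows "(\<lambda>i. a i * b i) summable_on A"
    and "(\<Sum>\<^sub>\<infinity>i\<in>A. a i * b i) \<le> sqrt (\<Sum>\<^sub>\<infinity>i\<in>A. (a i)\<^sup>2) * sqrt (\<Sum>\<^sub>\<infinity>i\<in>A. (b i)\<^sup>2)"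
proof -
  let ?B = "sqrt (\<Sum>\<^sub>\<infinity>i\<in>A. (a i)\<^sup>2) * sqrt (\<Sum>\<^sub>\<infinity>i\<in>A. (b i)\<^sup>2)"
  have bound: "(\<Sum>i\<in>F. a i * b i) \<le> ?B" if F: "finite F" "F \<subseteq> A" for F
  proof -
    have "(\<Sum>i\<in>F. a i * b i) \<le> (\<Sum>i\<in>F. \<bar>a i\<bar> * \<bar>b i\<bar>)"
      by (intro sum_mono) (metis abs_ge_self abs_mult)
    also have "\<dots> \<le> L2_set a F * L2_set b F"
      by (rule L2_set_mult_ineq)
    also have "\<dots> \<le> ?B"
      unfolding L2_set_def
      by (intro mult_mono real_sqrt_le_mono finite_sum_le_infsum a b F)
        (auto intro!: infsum_nonneg sum_nonneg)
    finally show ?thesis .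
  qed
  show summable: "(\<lambda>i. a i * b i) summable_on A"
    by (rule nonneg_bdd_above_summable_on) (use bound nonneg in \<open>auto intro!: bdd_aboveI2\<close>)
  show "(\<Sum>\<^sub>\<infinity>i\<in>A. a i * b i) \<le> ?B"
    by (rule infsum_le_finite_sums[OF summable bound])
qed

lemma continuous_uminus_group:
  "continuous_on UNIV (uminus :: 'g::topological_ab_group_add \<Rightarrow> 'g)"
  by (intro continuous_intros)

lemma continuous_dual_app: "continuous_on UNIV (dual_app \<gamma>)"
  using dual_app[of \<gamma>] by simp

lemma open_plus_image:
  fixes U :: "'g::topological_ab_group_add set"
  assumes "open U"
  shows "open ((+) x ` U)"
proof -
  have "(+) x ` U = (\<lambda>y. - x + y) -` U"
  proof (intro subset_antisym subsetI)
    fix y assume "y \<in> (\<lambda>y. - x + y) -` U"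
    then show "y \<in> (+) x ` U"
      by (intro image_eqI[of _ _ "- x + y"]) simp_all
  qed auto
  moreover have "continuous_on UNIV (\<lambda>y. - x + y)"
    by (intro continuous_on_add continuous_on_const continuous_on_id)
  ultimately show ?thesis
    using open_vimage[OF assms] by metis
qed

lemma haar_open_pos:
  fixes \<mu> :: "'g::{topological_ab_group_add, t2_space} measure"
  assumes compact: "compact (UNIV :: 'g set)" and haar: "normalized_haar \<mu>"
    and U: "open U" "U \<noteq> {}"
  shows "emeasure \<mu> U > 0"
proof (rule ccontr)
  assume "\<not> emeasure \<mu> U > 0"
  then have null: "emeasure \<mu> U = 0"
    by simp
  have sets: "sets \<mu> = sets borel" and prob: "prob_space \<mu>"
    and inv: "\<And>x A. A \<in> sets borel \<Longrightarrow> emeasure \<mu> ((+) x ` A) = emeasure \<mu> A"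
    using haar by (auto simp: normalized_haar_def)
  obtain u where u: "u \<in> U"
    using U by blast
  have cover: "UNIV \<subseteq> (\<Union>x\<in>UNIV. (+) x ` U)"
  proof (rule subsetI)
    fix y
    \<comment> \<open>Translation by \<open>y - u\<close> carries the fixed point \<open>u\<close>
      of \<open>U\<close> to \<open>y\<close>.\<close>
    show "y \<in> (\<Union>x\<in>UNIV. (+) x ` U)"
      using imageI[OF u, of "(+) (y - u)"] by (intro UN_I[of "y - u"]) simp_all
  qed
  obtain D where D: "finite D" "UNIV \<subseteq> (\<Union>x\<in>D. (+) x ` U)"
    using compactE_image[OF compact open_plus_image[OF U(1)] cover] .
  have meas: "(+) x ` U \<in> sets \<mu>" for x
    using open_plus_image[OF U(1)] sets by simp
  \<comment> \<open>By invariance each of the finitely many translates is null, so the whole group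
    would be null, against total mass one.\<close>
  have "emeasure \<mu> (\<Union>x\<in>D. (+) x ` U) \<le> (\<Sum>x\<in>D. emeasure \<mu> ((+) x ` U))"
    using D(1) meas by (intro emeasure_subadditive_finite) auto
  also have "\<dots> = 0"
    using inv[of U] U(1) null by simp
  finally have "emeasure \<mu> UNIV = 0"
    using subset_antisym[OF D(2) subset_UNIV] by simp
  moreover have "space \<mu> = UNIV"
    using sets_eq_imp_space_eq[OF sets] by simp
  ultimately show False
    using prob_space.emeasure_space_1[OF prob] by simp
qed

text \<open>The set of disagreement is open, since the codomain is Hausdorff, and it is null by
  assumption; a null open set is empty by \<open>haar_open_pos\<close>.\<close>

lemma continuous_AE_eq_imp_eq:
  fixes f g :: "'g::{topological_ab_group_add, t2_space} \<Rightarrow> 'b::t2_space"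
  assumes compact: "compact (UNIV :: 'g set)" and haar: "normalized_haar \<mu>"
    and f: "continuous_on UNIV f" and g: "continuous_on UNIV g"
    and eq: "AE x in \<mu>. f x = g x"
  shows "f = g"
proof -
  have U: "open {x. f x \<noteq> g x}"
    using open_Collect_neq[OF f g] .
  have sets: "sets \<mu> = sets borel"
    using haar by (simp add: normalized_haar_def)
  have "{x. f x \<noteq> g x} \<in> null_sets \<mu>"
    using eq U sets sets_eq_imp_space_eq[OF sets] by (subst (asm) AE_iff_null) auto
  then have "{x. f x \<noteq> g x} = {}"
    using haar_open_pos[OF compact haar U] by (metis less_irrefl null_setsD1)
  then show ?thesis
    by auto
qed

text \<open>Compactness makes \<open>f\<close> bounded, and bounded measurable functions are
  integrable for a finite measure.\<close>

lemma integrable_continuous_haar: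
  fixes f :: "'g::{topological_ab_group_add, t2_space} \<Rightarrow> complex"
  assumes compact: "compact (UNIV :: 'g set)" and haar: "normalized_haar \<mu>"
    and f: "continuous_on UNIV f"
  shows "integrable \<mu> f"
proof -
  have sets: "sets \<mu> = sets borel" and prob: "prob_space \<mu>"
    using haar by (auto simp: normalized_haar_def)
  interpret prob_space \<mu> by (rule prob)
  obtain B where "\<And>x. norm (f x) \<le> B"
    using compact_imp_bounded[OF compact_continuous_image[OF f compact]]
    by (auto simp: bounded_iff)
  moreover have "f \<in> borel_measurable \<mu>"
    using borel_measurable_continuous_onI[OF f] measurable_cong_sets[OF sets refl] by blast
  ultimately show ?thesis
    by (intro integrable_const_bound) auto
qed

text \<open>Splitting the integral requires both integrands to be integrable; they are continuous,
  being products of continuous functions with a reflected character.\<close>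

lemma fourier_diff:
  fixes f g :: "'g::{topological_ab_group_add, t2_space} \<Rightarrow> complex"
  assumes compact: "compact (UNIV :: 'g set)" and haar: "normalized_haar \<mu>"
    and f: "continuous_on UNIV f" and g: "continuous_on UNIV g"
  shows "fourier \<mu> (\<lambda>x. f x - g x) \<gamma> = fourier \<mu> f \<gamma> - fourier \<mu> g \<gamma>"
proof -
  have "integrable \<mu> (\<lambda>x. h x * dual_app \<gamma> (- x))" if "continuous_on UNIV h" for h
    by (intro integrable_continuous_haar[OF compact haar] continuous_on_mult that
        continuous_on_compose2[OF continuous_dual_app continuous_uminus_group]) simp
  then show ?thesis
    unfolding fourier_def left_diff_distrib using f g by (intro Bochner_Integration.integral_diff)
qed

text \<open>The continuity clause of \<open>continuously_embedded\<close> measures differences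
  \<open>g - f\<close>, so the norm bound for single members has to be applicable to them.\<close>

lemma rkhs_diff:
  fixes \<mu> :: "'g::{topological_ab_group_add, t2_space} measure"
  assumes compact: "compact (UNIV :: 'g set)" and haar: "normalized_haar \<mu>"
    and \<kappa>: "\<And>\<gamma>. \<kappa> \<gamma> > 0"
    and f: "f \<in> rkhs \<mu> \<kappa>" and g: "g \<in> rkhs \<mu> \<kappa>"
  shows "(\<lambda>x. f x - g x) \<in> rkhs \<mu> \<kappa>"
proof -
  have cont: "continuous_on UNIV f" "continuous_on UNIV g"
    using f g by (auto simp: rkhs_def)
  \<comment> \<open>The factor 2 absorbs the cross term of \<open>(cmod u + cmod v)\<^sup>2\<close>,
    because \<open>(cmod u - cmod v)\<^sup>2\<close> is nonnegative.\<close>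
  have parallelogram: "(cmod (u - v))\<^sup>2 \<le> 2 * (cmod u)\<^sup>2 + 2 * (cmod v)\<^sup>2" for u v
  proof -
    have "(cmod (u - v))\<^sup>2 \<le> (cmod u + cmod v)\<^sup>2"
      by (intro power_mono norm_triangle_ineq4) simp
    also have "\<dots> \<le> 2 * (cmod u)\<^sup>2 + 2 * (cmod v)\<^sup>2"
      using zero_le_power2[of "cmod u - cmod v"] by (simp add: power2_eq_square algebra_simps)
    finally show ?thesis .
  qed
  have "(\<lambda>\<gamma>. 2 * ((cmod (fourier \<mu> f \<gamma>))\<^sup>2 / \<kappa> \<gamma>) + 2 * ((cmod (fourier \<mu> g \<gamma>))\<^sup>2 / \<kappa> \<gamma>))
      summable_on UNIV"
    using f g by (intro summable_on_add summable_on_cmult_right) (auto simp: rkhs_def)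
  then have "(\<lambda>\<gamma>. (cmod (fourier \<mu> (\<lambda>x. f x - g x) \<gamma>))\<^sup>2 / \<kappa> \<gamma>) summable_on UNIV"
  proof (rule summable_on_comparison_test)
    fix \<gamma>
    show "(cmod (fourier \<mu> (\<lambda>x. f x - g x) \<gamma>))\<^sup>2 / \<kappa> \<gamma>
        \<le> 2 * ((cmod (fourier \<mu> f \<gamma>))\<^sup>2 / \<kappa> \<gamma>) + 2 * ((cmod (fourier \<mu> g \<gamma>))\<^sup>2 / \<kappa> \<gamma>)"
      using divide_right_mono[OF parallelogram less_imp_le[OF \<kappa>[of \<gamma>]]]
      by (simp add: fourier_diff[OF compact haar cont] add_divide_distrib)
    show "0 \<le> (cmod (fourier \<mu> (\<lambda>x. f x - g x) \<gamma>))\<^sup>2 / \<kappa> \<gamma>"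
      using \<kappa>[of \<gamma>] by simp
  qed
  then show ?thesis
    using cont by (auto simp: rkhs_def intro: continuous_on_diff)
qed

text \<open>Cauchy-Schwarz works for any positive \<open>\<kappa>\<close> such that
  \<open>w\<^sup>2 * \<kappa>\<close> is summable; the root of that sum is the embedding constant
  \<open>C\<close>.\<close>

lemma rkhs_embeds_wermer:
  fixes \<mu> :: "'g::{topological_ab_group_add, t2_space} measure"
  assumes compact: "compact (UNIV :: 'g set)" and haar: "normalized_haar \<mu>"
    and w: "\<And>\<gamma>. w \<gamma> \<ge> 0" and \<kappa>: "\<And>\<gamma>. \<kappa> \<gamma> > 0"
    and summable: "(\<lambda>\<gamma>. (w \<gamma>)\<^sup>2 * \<kappa> \<gamma>) summable_on UNIV"
  shows "continuously_embedded \<mu> (rkhs \<mu> \<kappa>) (rkhs_norm \<mu> \<kappa>) (wermer_space \<mu> w) (wermer_norm \<mu> w)"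
proof -
  define C where "C = sqrt (\<Sum>\<^sub>\<infinity>\<gamma>. (w \<gamma>)\<^sup>2 * \<kappa> \<gamma>)"
  have C: "C \<ge> 0"
    unfolding C_def using \<kappa> by (auto intro!: infsum_nonneg simp: less_imp_le)
  have bound: "f \<in> wermer_space \<mu> w" "wermer_norm \<mu> w f \<le> C * rkhs_norm \<mu> \<kappa> f"
    if f: "f \<in> rkhs \<mu> \<kappa>" for f
  proof -
    \<comment> \<open>The factor \<open>sqrt (\<kappa> \<gamma>)\<close> cancels in the product,
      while the squares are the summands of \<open>C\<^sup>2\<close> and of the squared kernel
      norm.\<close>
    let ?a = "\<lambda>\<gamma>. w \<gamma> * sqrt (\<kappa> \<gamma>)" and ?b = "\<lambda>\<gamma>. cmod (fourier \<mu> f \<gamma>) / sqrt (\<kappa> \<gamma>)"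
    have sq: "(?a \<gamma>)\<^sup>2 = (w \<gamma>)\<^sup>2 * \<kappa> \<gamma>" "(?b \<gamma>)\<^sup>2 = (cmod (fourier \<mu> f \<gamma>))\<^sup>2 / \<kappa> \<gamma>"
      "?a \<gamma> * ?b \<gamma> = w \<gamma> * cmod (fourier \<mu> f \<gamma>)" for \<gamma>
      using \<kappa>[of \<gamma>] by (simp_all add: power_mult_distrib power_divide)
    have a: "(\<lambda>\<gamma>. (?a \<gamma>)\<^sup>2) summable_on UNIV"
      unfolding sq by (rule summable)
    have b: "(\<lambda>\<gamma>. (?b \<gamma>)\<^sup>2) summable_on UNIV"
      unfolding sq using f by (simp add: rkhs_def)
    have nonneg: "?a \<gamma> \<ge> 0" "?b \<gamma> \<ge> 0" for \<gamma>
      using w[of \<gamma>] \<kappa>[of \<gamma>] by simp_all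
    note CS = Cauchy_Schwarz_infsum[OF a b nonneg, unfolded sq]
    have "integrable \<mu> f"
      using f by (intro integrable_continuous_haar[OF compact haar]) (simp add: rkhs_def)
    with CS(1) show "f \<in> wermer_space \<mu> w"
      by (simp add: wermer_space_def)
    show "wermer_norm \<mu> w f \<le> C * rkhs_norm \<mu> \<kappa> f"
      using CS(2) by (simp add: wermer_norm_def rkhs_norm_def C_def)
  qed
  have "\<exists>d>0. \<forall>g\<in>rkhs \<mu> \<kappa>. rkhs_norm \<mu> \<kappa> (\<lambda>x. g x - f x) < d \<longrightarrow> wermer_norm \<mu> w (\<lambda>x. g x - f x) < e"
    if f: "f \<in> rkhs \<mu> \<kappa>" and e: "e > 0" for f e
  \<comment> \<open>Dividing by \<open>C + 1\<close> rather than \<open>C\<close> also covers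
    \<open>C = 0\<close>.\<close>
  proof (intro exI[of _ "e / (C + 1)"] conjI ballI impI)
    show "e / (C + 1) > 0"
      using e C by simp
    fix g
    let ?h = "\<lambda>x. g x - f x"
    assume g: "g \<in> rkhs \<mu> \<kappa>" and less: "rkhs_norm \<mu> \<kappa> ?h < e / (C + 1)"
    have "rkhs_norm \<mu> \<kappa> ?h \<ge> 0"
      unfolding rkhs_norm_def using \<kappa> by (auto intro!: infsum_nonneg simp: less_imp_le)
    then have "C * rkhs_norm \<mu> \<kappa> ?h \<le> (C + 1) * rkhs_norm \<mu> \<kappa> ?h"
      by (intro mult_right_mono) auto
    also have "\<dots> < e"
      using less C by (simp add: field_simps)
    finally show "wermer_norm \<mu> w ?h < e"
      using bound(2)[OF rkhs_diff[OF compact haar \<kappa> g f]] by linarith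
  qed
  moreover have "f = g"
    if "f \<in> rkhs \<mu> \<kappa>" "g \<in> rkhs \<mu> \<kappa>" "AE x in \<mu>. f x = g x" for f g
    using continuous_AE_eq_imp_eq[OF compact haar] that by (auto simp: rkhs_def)
  ultimately show ?thesis
    unfolding continuously_embedded_def using bound by blast
qed

theorem mainTheorem4:
  fixes \<mu> :: "'g::{topological_ab_group_add, t2_space} measure"
    and w lam :: "'g dual \<Rightarrow> real"
  assumes compact: "compact (UNIV :: 'g set)"
    and haar: "normalized_haar \<mu>"
    and w_pos: "\<And>\<gamma>. w \<gamma> > 0"
    and w_bounded_away: "\<exists>c>0. \<forall>\<gamma>. c \<le> w \<gamma>"
    and lam_def: "lam = (\<lambda>\<gamma>. w \<gamma> powr (- 2))"
    and w_inv: "subconvolutive (\<lambda>\<gamma>. inverse (w \<gamma>))"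
    and lam_l1: "lam \<in> ell1"
    and lam_pos: "\<And>\<gamma>. lam \<gamma> > 0"
    and lam_sym: "\<And>\<gamma>. lam (- \<gamma>) = lam \<gamma>"
    and lam_subconv: "subconvolutive lam"
    and lam_powr_l1: "\<And>\<epsilon>::real. \<epsilon> > 0 \<Longrightarrow> (\<lambda>\<gamma>. lam \<gamma> powr \<epsilon>) \<in> ell1"
    and lam_powr_pos: "\<And>(\<epsilon>::real) \<gamma>. \<epsilon> > 0 \<Longrightarrow> lam \<gamma> powr \<epsilon> > 0"
    and lam_powr_sym: "\<And>(\<epsilon>::real) \<gamma>. \<epsilon> > 0 \<Longrightarrow> lam (- \<gamma>) powr \<epsilon> = lam \<gamma> powr \<epsilon>"
    and lam_powr_subconv: "\<And>\<epsilon>::real. \<epsilon> > 0 \<Longrightarrow> subconvolutive (\<lambda>\<gamma>. lam \<gamma> powr \<epsilon>)"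
  shows "\<forall>\<epsilon>::real. \<epsilon> > 0 \<longrightarrow>
           continuously_embedded \<mu>
             (rkhs \<mu> (\<lambda>\<gamma>. lam \<gamma> powr (1 + \<epsilon>))) (rkhs_norm \<mu> (\<lambda>\<gamma>. lam \<gamma> powr (1 + \<epsilon>)))
             (wermer_space \<mu> w) (wermer_norm \<mu> w)"
proof (intro allI impI)
  fix \<epsilon> :: real
  assume \<epsilon>: "\<epsilon> > 0"
  have "(w \<gamma>)\<^sup>2 * lam \<gamma> powr (1 + \<epsilon>) = lam \<gamma> powr \<epsilon>" for \<gamma>
  proof -
    have "(w \<gamma>)\<^sup>2 * lam \<gamma> = 1"
      using w_pos[of \<gamma>] by (simp add: lam_def powr_minus)
    then show ?thesis
      using lam_pos[of \<gamma>] by (simp add: powr_add flip: mult.assoc)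
  qed
  \<comment> \<open>Membership in \<open>ell1\<close> is absolute summability; powers are
    nonnegative, so the absolute value disappears.\<close>
  then have "(\<lambda>\<gamma>. (w \<gamma>)\<^sup>2 * lam \<gamma> powr (1 + \<epsilon>)) summable_on UNIV"
    using lam_powr_l1[OF \<epsilon>] by (simp add: ell1_def)
  then show "continuously_embedded \<mu>
      (rkhs \<mu> (\<lambda>\<gamma>. lam \<gamma> powr (1 + \<epsilon>))) (rkhs_norm \<mu> (\<lambda>\<gamma>. lam \<gamma> powr (1 + \<epsilon>)))
      (wermer_space \<mu> w) (wermer_norm \<mu> w)"
    using w_pos lam_powr_pos \<epsilon> by (intro rkhs_embeds_wermer[OF compact haar]) (auto simp: less_imp_le)
qed

end
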